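(* For any constant $\delta\in(0,1/2)$ and any symmetric norm $\|\cdot\|_X$ on $\mathbb{R}^d$, there exist $t=d^{O(\log(1/\delta)\delta^{-1})}$ and nonnegative reals $c\in\mathbb{R}_+^{t\times d}$ such that for every $x\in\mathbb{R}^d$, \[(1-\delta)\|x\|_X\le \max_{i\in[t]}\left(\sum_{k=1}^d c_{i,k}\|x\|_{T(k)}\right)\le(1+\delta)\|x\|_X.\] Equivalently, $\|\cdot\|_X$ embeds linearly with distortion $1+\delta$ into $\bigoplus_{\ell_\infty}^t\bigoplus_{\ell_1}^d T^{(c)}$ (via the map copying $x$ into each of the $td$ blocks).
   Context: A norm $\|\cdot\|_X$ on $\mathbb{R}^d$ is symmetric if $\|x\|_X=\|(|x_1|,\dots,|x_d|)\|_X$ and $\|x\|_X$ is invariant under permutations of the coordinates of $x$. For $x\in\mathbb{R}^d$, $x^*$ is the vector of absolute values of coordinates of $x$ sorted in non-increasing order, and the top-$k$ norm is $\|x\|_{T(k)}=\sum_{i=1}^k x^*_i$. For $c_1,\dots,c_d\ge 0$, $\bigoplus_{\ell_1}^d T^{(c)}$ denotes $\mathbb{R}^{d^2}$ with the seminorm $\|(x_1,\dots,x_d)\|^{(c)}_{T,1}=\sum_{k=1}^d c_k\|x_k\|_{T(k)}$ (where $x_k\in\mathbb{R}^d$), and $\bigoplus_{\ell_\infty}^t$ of such spaces (with coefficient rows $c_{i,\cdot}$) is their product with the maximum of the $t$ seminorms. The implied constant in the $O(\cdot)$ is absolute. *)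

theory Defs
  imports Complex_Main "HOL-Combinatorics.Permutations" "Jordan_Normal_Form.Matrix"
begin

text \<open>
  The dimension is quantified inside the main statement (the implied constant must not depend
  on it), so \<open>\<real>\<^sup>d\<close> is \<^term>\<open>carrier_vec d :: real vec set\<close>. All indices are 0-based.
\<close>

definition norm_on :: "nat \<Rightarrow> (real vec \<Rightarrow> real) \<Rightarrow> bool" where
  "norm_on d N \<longleftrightarrow>
     (\<forall>x\<in>carrier_vec d. 0 \<le> N x) \<and>
     (\<forall>x\<in>carrier_vec d. N x = 0 \<longleftrightarrow> x = 0\<^sub>v d) \<and>
     (\<forall>a. \<forall>x\<in>carrier_vec d. N (a \<cdot>\<^sub>v x) = \<bar>a\<bar> * N x) \<and>
     (\<forall>x\<in>carrier_vec d. \<forall>y\<in>carrier_vec d. N (x + y) \<le> N x + N y)"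

definition symmetric_norm_on :: "nat \<Rightarrow> (real vec \<Rightarrow> real) \<Rightarrow> bool" where
  "symmetric_norm_on d N \<longleftrightarrow>
     norm_on d N \<and>
     (\<forall>x\<in>carrier_vec d. N x = N (map_vec abs x)) \<and>
     (\<forall>\<pi>. \<pi> permutes {..<d} \<longrightarrow>
        (\<forall>x\<in>carrier_vec d. N (vec d (\<lambda>i. x $ \<pi> i)) = N x))"

definition decreasing_rearrangement :: "real vec \<Rightarrow> real vec" where
  "decreasing_rearrangement x = vec_of_list (rev (sort (map abs (list_of_vec x))))"

definition top_norm :: "nat \<Rightarrow> real vec \<Rightarrow> real" where
  "top_norm k x = (\<Sum>i<k. decreasing_rearrangement x $ i)"

text \<open>A finite product of copies of \<open>\<real>\<^sup>n\<close> is flattened to a single vector;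
  \<open>vec_block n k x\<close> is its \<open>k\<close>-th component.\<close>

definition vec_block :: "nat \<Rightarrow> nat \<Rightarrow> real vec \<Rightarrow> real vec" where
  "vec_block n k x = vec n (\<lambda>j. x $ (k * n + j))"

text \<open>The seminorm of \<open>\<Oplus>\<^sub>\<ell>\<^sub>1 T\<close> on \<open>\<real>\<^bsup>d\<^sup>2\<^esup>\<close>, where \<open>d = dim_vec c\<close>; entry \<open>k\<close> of \<open>c\<close> is the
  coefficient of the top-\<open>(k+1)\<close> norm.\<close>

definition l1_sum_top :: "real vec \<Rightarrow> real vec \<Rightarrow> real" where
  "l1_sum_top c x =
     (\<Sum>k<dim_vec c. c $ k * top_norm (Suc k) (vec_block (dim_vec c) k x))"

text \<open>The \<open>\<ell>\<^sub>\<infinity>\<close>-sum of the spaces above over the rows of \<open>c\<close>, on \<open>\<real>\<^bsup>t d\<^sup>2\<^esup>\<close> for a nonempty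
  \<open>t \<times> d\<close> matrix \<open>c\<close>.\<close>

definition linf_sum_l1_sum_top :: "real mat \<Rightarrow> real vec \<Rightarrow> real" where
  "linf_sum_l1_sum_top c x =
     Max ((\<lambda>i. l1_sum_top (row c i) (vec_block (dim_col c * dim_col c) i x)) ` {..<dim_row c})"

definition copy_map :: "nat \<Rightarrow> nat \<Rightarrow> real vec \<Rightarrow> real vec" where
  "copy_map t d x = vec (t * (d * d)) (\<lambda>j. x $ (j mod d))"

definition linear_vec_map :: "nat \<Rightarrow> nat \<Rightarrow> (real vec \<Rightarrow> real vec) \<Rightarrow> bool" where
  "linear_vec_map n m f \<longleftrightarrow>
     f \<in> carrier_vec n \<rightarrow> carrier_vec m \<and>
     (\<forall>x\<in>carrier_vec n. \<forall>y\<in>carrier_vec n. f (x + y) = f x + f y) \<and>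
     (\<forall>a. \<forall>x\<in>carrier_vec n. f (a \<cdot>\<^sub>v x) = a \<cdot>\<^sub>v f x)"

text \<open>Distortion is, as usual, up to a global rescaling of the target.\<close>

definition linear_embedding_with_distortion ::
  "real \<Rightarrow> nat \<Rightarrow> (real vec \<Rightarrow> real) \<Rightarrow> nat \<Rightarrow> (real vec \<Rightarrow> real) \<Rightarrow> (real vec \<Rightarrow> real vec) \<Rightarrow> bool"
where
  "linear_embedding_with_distortion D n M m N f \<longleftrightarrow>
     linear_vec_map n m f \<and>
     (\<exists>r>0. \<forall>x\<in>carrier_vec n. \<forall>y\<in>carrier_vec n.
        r * M (x - y) \<le> N (f x - f y) \<and> N (f x - f y) \<le> D * r * M (x - y))"

end

theory Submission imports Defs begin

text \<open>
  By duality \<open>N x\<close> is the maximum of \<open>\<langle>x\<^sup>*, y\<rangle>\<close> over the nonincreasing \<open>y \<ge> 0\<close> in the dual unit ball, and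
  summation by parts turns \<open>\<langle>x\<^sup>*, y\<rangle>\<close> into \<open>\<Sum>\<^sub>k (y\<^sub>k - y\<^sub>k\<^sub>+\<^sub>1) T(k)(x)\<close>. So it suffices to replace the \<open>y\<close>
  by a small net inside the ball. With \<open>e = \<delta>/8\<close>, positions are grouped into blocks with endpoints
  \<open>(1+e)\<^sup>j\<close>, and \<open>y\<close> is replaced on each block by its last value; this costs a factor \<open>1 + 2e\<close> because
  \<open>T(k)/k\<close> is nonincreasing in \<open>k\<close>. Values are rounded down to \<open>a/(1+e)\<^sup>l\<close>, where \<open>a\<close> is the norm of a
  unit vector, and to \<open>0\<close> below \<open>ea/d\<close>; the latter costs at most \<open>e a x\<^sup>*\<^sub>1 \<le> e N x\<close>. What remains is a
  monotone map between two sets of size \<open>O(log(d/\<delta>)/\<delta>)\<close>, and there are only \<open>2\<close> to the power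
  \<open>O(log(d/\<delta>)/\<delta>)\<close> of these.
\<close>

section \<open>Decreasing rearrangement of a vector\<close>

lemma dim_decreasing_rearrangement [simp]:
  "dim_vec (decreasing_rearrangement x) = dim_vec x"
  by (simp add: decreasing_rearrangement_def)

text \<open>Sorting preserves the multiset of absolute values, so it is realised by a permutation of
  the indices. In this form the permutation invariance of a norm applies to the sorted
  vector.\<close>

lemma decreasing_rearrangement_permutation:
  obtains \<pi> where "\<pi> permutes {..<dim_vec x}"
    and "\<And>i. i < dim_vec x \<Longrightarrow> decreasing_rearrangement x $ i = \<bar>x $ \<pi> i\<bar>"
proof -
  let ?xs = "map abs (list_of_vec x)"
  have "mset (rev (sort ?xs)) = mset ?xs" by simp
  then obtain \<pi> where \<pi>: "\<pi> permutes {..<length ?xs}" "permute_list \<pi> ?xs = rev (sort ?xs)"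
    by (rule mset_eq_permutation)
  have "decreasing_rearrangement x $ i = \<bar>x $ \<pi> i\<bar>" if "i < dim_vec x" for i
  proof -
    have "\<pi> i < dim_vec x" using \<pi>(1) that permutes_in_image[of \<pi> "{..<dim_vec x}" i] by simp
    then have "permute_list \<pi> ?xs ! i = \<bar>x $ \<pi> i\<bar>"
      using \<pi>(1) that by (simp add: permute_list_nth list_of_vec_index)
    then show ?thesis using that unfolding decreasing_rearrangement_def
      by (simp add: \<pi>(2)[symmetric] vec_of_list_index)
  qed
  with \<pi>(1) show thesis by (intro that) auto
qed

text \<open>The extension by 0 makes the sequence antimono on all of \<open>nat\<close>, so facts
  about antimono sequences apply without range conditions.\<close>

definition decr_coord :: "real vec \<Rightarrow> nat \<Rightarrow> real" where
  "decr_coord x i = (if i < dim_vec x then decreasing_rearrangement x $ i else 0)"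

lemma decr_coord_nonneg: "0 \<le> decr_coord x i"
proof -
  obtain \<pi> where "\<And>i. i < dim_vec x \<Longrightarrow> decreasing_rearrangement x $ i = \<bar>x $ \<pi> i\<bar>"
    using decreasing_rearrangement_permutation by blast
  then show ?thesis by (simp add: decr_coord_def)
qed

lemma decr_coord_antimono: "antimono (decr_coord x)"
proof (rule antimonoI)
  fix i j :: nat assume "i \<le> j"
  show "decr_coord x j \<le> decr_coord x i"
  proof (cases "j < dim_vec x")
    case True
    then have "rev (sort (map abs (list_of_vec x))) ! j \<le> rev (sort (map abs (list_of_vec x))) ! i"
      using \<open>i \<le> j\<close> by (intro sorted_rev_nth_mono) auto
    then show ?thesis
      using True \<open>i \<le> j\<close> by (simp add: decr_coord_def decreasing_rearrangement_def vec_of_list_index)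
  next
    case False
    then show ?thesis using decr_coord_nonneg[of x i] by (simp add: decr_coord_def)
  qed
qed

lemma decr_coord_eq_0: "dim_vec x \<le> i \<Longrightarrow> decr_coord x i = 0"
  by (simp add: decr_coord_def)

lemma top_norm_eq_sum_decr_coord:
  "k \<le> dim_vec x \<Longrightarrow> top_norm k x = (\<Sum>i<k. decr_coord x i)"
  unfolding top_norm_def decr_coord_def by (intro sum.cong) auto

section \<open>Elementary facts on symmetric norms\<close>

lemma
  assumes "symmetric_norm_on d N"
  shows symmetric_norm_scale: "x \<in> carrier_vec d \<Longrightarrow> N (a \<cdot>\<^sub>v x) = \<bar>a\<bar> * N x"
    and symmetric_norm_triangle:
      "x \<in> carrier_vec d \<Longrightarrow> y \<in> carrier_vec d \<Longrightarrow> N (x + y) \<le> N x + N y"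
    and symmetric_norm_nonneg: "x \<in> carrier_vec d \<Longrightarrow> 0 \<le> N x"
    and symmetric_norm_abs: "x \<in> carrier_vec d \<Longrightarrow> N (map_vec abs x) = N x"
    and symmetric_norm_permute:
      "x \<in> carrier_vec d \<Longrightarrow> \<pi> permutes {..<d} \<Longrightarrow> N (vec d (\<lambda>i. x $ \<pi> i)) = N x"
proof -
  note N = assms[unfolded symmetric_norm_on_def norm_on_def]
  show "x \<in> carrier_vec d \<Longrightarrow> N (a \<cdot>\<^sub>v x) = \<bar>a\<bar> * N x"
    using N by blast
  show "x \<in> carrier_vec d \<Longrightarrow> y \<in> carrier_vec d \<Longrightarrow> N (x + y) \<le> N x + N y"
    using N by blast
  show "x \<in> carrier_vec d \<Longrightarrow> 0 \<le> N x"
    using N by blast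
  assume x: "x \<in> carrier_vec d"
  have "N x = N (map_vec abs x)" by (rule bspec[OF _ x]) (use N in blast)
  then show "N (map_vec abs x) = N x" by (rule sym)
  show "\<pi> permutes {..<d} \<Longrightarrow> N (vec d (\<lambda>i. x $ \<pi> i)) = N x"
    using N x by blast
qed

text \<open>\<open>vec d f\<close> and the permuted \<open>x\<close> agree after taking absolute
  values, so the two invariances combine into invariance under signed permutations.\<close>

lemma norm_permute_signs:
  assumes N: "symmetric_norm_on d N" and x: "x \<in> carrier_vec d" and \<pi>: "\<pi> permutes {..<d}"
    and f: "\<And>i. i < d \<Longrightarrow> \<bar>f i\<bar> = \<bar>x $ \<pi> i\<bar>"
  shows "N (vec d f) = N x"
proof -
  have "N (vec d f) = N (map_vec abs (vec d f))"
    by (rule symmetric_norm_abs[OF N, symmetric]) simp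
  also have "map_vec abs (vec d f) = map_vec abs (vec d (\<lambda>i. x $ \<pi> i))"
    using f by (intro eq_vecI) auto
  also have "N \<dots> = N (vec d (\<lambda>i. x $ \<pi> i))"
    by (rule symmetric_norm_abs[OF N]) simp
  also have "\<dots> = N x"
    by (rule symmetric_norm_permute[OF N x \<pi>])
  finally show ?thesis .
qed

lemma norm_decr_coord:
  assumes "symmetric_norm_on d N" "x \<in> carrier_vec d"
  shows "N (vec d (decr_coord x)) = N x"
proof -
  have "dim_vec x = d" using assms by auto
  obtain \<pi> where "\<pi> permutes {..<dim_vec x}"
    and "\<And>i. i < dim_vec x \<Longrightarrow> decreasing_rearrangement x $ i = \<bar>x $ \<pi> i\<bar>"
    using decreasing_rearrangement_permutation by blast
  then show ?thesis
    using assms \<open>dim_vec x = d\<close> by (intro norm_permute_signs[of d N x \<pi>]) (auto simp: decr_coord_def)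
qed

section \<open>Supporting functionals of sublinear functionals\<close>

text \<open>Homogeneity is demanded only as an inequality for \<open>a > 0\<close>. Applying it to
  \<open>1 / a\<close> as well gives equality, and the value 0 at 0 follows.\<close>

definition sublinear :: "(('i \<Rightarrow> real) \<Rightarrow> real) \<Rightarrow> bool" where
  "sublinear p \<longleftrightarrow> (\<forall>f g. p (\<lambda>i. f i + g i) \<le> p f + p g) \<and>
     (\<forall>a>0. \<forall>f. p (\<lambda>i. a * f i) \<le> a * p f)"

lemma sublinear_add: "sublinear p \<Longrightarrow> p (\<lambda>i. f i + g i) \<le> p f + p g"
  by (simp add: sublinear_def)

lemma sublinear_scale_le: "sublinear p \<Longrightarrow> 0 < a \<Longrightarrow> p (\<lambda>i. a * f i) \<le> a * p f"
  by (simp add: sublinear_def)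

lemma sublinear_scale_pos:
  assumes "sublinear p" "0 < a" shows "p (\<lambda>i. a * f i) = a * p f"
proof (rule antisym)
  have "p (\<lambda>i. (1 / a) * (a * f i)) \<le> (1 / a) * p (\<lambda>i. a * f i)"
    using assms sublinear_scale_le[of p "1 / a" "\<lambda>i. a * f i"] by simp
  then show "a * p f \<le> p (\<lambda>i. a * f i)" using assms by (simp add: field_simps)
qed (use assms in \<open>rule sublinear_scale_le\<close>)

lemma sublinear_zero: "sublinear p \<Longrightarrow> p (\<lambda>i. 0) = 0"
  using sublinear_scale_pos[of p 2 "\<lambda>i. 0"] by simp

lemma sublinear_neg_ge: "sublinear p \<Longrightarrow> - p (\<lambda>i. - f i) \<le> p f"
  using sublinear_add[of p f "\<lambda>i. - f i"] sublinear_zero[of p] by simp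

text \<open>A step of the Hahn--Banach theorem without subspaces: passing from \<open>p\<close> to
  \<open>q f = inf {p (f + t v) - t p v | t \<ge> 0}\<close> makes the functional linear along \<open>v\<close>, and linearity along
  a vector survives passing to a smaller sublinear functional.\<close>

lemma sublinear_linearize:
  fixes p :: "('i \<Rightarrow> real) \<Rightarrow> real"
  assumes p: "sublinear p"
  obtains q where "sublinear q" "\<And>f. q f \<le> p f" "q (\<lambda>i. - v i) \<le> - p v"
proof -
  define F where "F f t = p (\<lambda>i. f i + t * v i) - t * p v" for f t
  define q where "q f = (INF t\<in>{0..}. F f t)" for f
  \<comment> \<open>A lower bound independent of \<open>t\<close>, from subadditivity on
    \<open>t v = (f + t v) + (- f)\<close>. It makes the infimum in \<open>q\<close>
    meaningful.\<close>
  have F_lower: "- p (\<lambda>i. - f i) \<le> F f t" if "0 \<le> t" for f t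
  proof (cases "t = 0")
    case True then show ?thesis using sublinear_neg_ge[OF p, of f] by (simp add: F_def)
  next
    case False
    have "p (\<lambda>i. t * v i) \<le> p (\<lambda>i. f i + t * v i) + p (\<lambda>i. - f i)"
      using sublinear_add[OF p, of "\<lambda>i. f i + t * v i" "\<lambda>i. - f i"] by simp
    then show ?thesis using False that sublinear_scale_pos[OF p, of t v] by (simp add: F_def)
  qed
  have bdd: "bdd_below (F f ` {0..})" for f
    using F_lower by (auto simp: bdd_below_def)
  have q_le: "q f \<le> F f t" if "0 \<le> t" for f t
    unfolding q_def using that bdd by (intro cINF_lower) auto
  have q_ge: "m \<le> q f" if "\<And>t. 0 \<le> t \<Longrightarrow> m \<le> F f t" for f m
    unfolding q_def using that by (intro cINF_greatest) auto
  have "sublinear q"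
    unfolding sublinear_def
  proof (intro conjI allI impI)
    fix f g
    \<comment> \<open>The infima for \<open>f\<close> and \<open>g\<close> use separate parameters
      \<open>s\<close> and \<open>t\<close>; the parameter \<open>s + t\<close> serves the
      sum.\<close>
    have "q (\<lambda>i. f i + g i) - F g t \<le> F f s" if "0 \<le> s" "0 \<le> t" for s t
    proof -
      have "q (\<lambda>i. f i + g i) \<le> F (\<lambda>i. f i + g i) (s + t)" using that by (intro q_le) auto
      also have "\<dots> = p (\<lambda>i. (f i + s * v i) + (g i + t * v i)) - (s + t) * p v"
        by (simp add: F_def algebra_simps)
      also have "\<dots> \<le> F f s + F g t"
        using sublinear_add[OF p, of "\<lambda>i. f i + s * v i" "\<lambda>i. g i + t * v i"]
        by (simp add: F_def algebra_simps)
      finally show ?thesis by simp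
    qed
    then have "q (\<lambda>i. f i + g i) - F g t \<le> q f" if "0 \<le> t" for t
      using that by (intro q_ge) auto
    then have "q (\<lambda>i. f i + g i) - q f \<le> F g t" if "0 \<le> t" for t
      using that by (smt (verit))
    then have "q (\<lambda>i. f i + g i) - q f \<le> q g" by (intro q_ge) auto
    then show "q (\<lambda>i. f i + g i) \<le> q f + q g" by simp
  next
    fix a :: real and f assume a: "0 < a"
    have "q (\<lambda>i. a * f i) / a \<le> F f t" if "0 \<le> t" for t
    proof -
      have "q (\<lambda>i. a * f i) \<le> F (\<lambda>i. a * f i) (a * t)" using that a by (intro q_le) auto
      also have "\<dots> = p (\<lambda>i. a * (f i + t * v i)) - a * t * p v"
        by (simp add: F_def algebra_simps)
      also have "\<dots> = a * F f t"
        using sublinear_scale_pos[OF p a, of "\<lambda>i. f i + t * v i"] by (simp add: F_def algebra_simps)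
      finally show ?thesis using a by (simp add: field_simps)
    qed
    then have "q (\<lambda>i. a * f i) / a \<le> q f" by (rule q_ge)
    then show "q (\<lambda>i. a * f i) \<le> a * q f" using a by (simp add: field_simps)
  qed
  moreover have "q f \<le> p f" for f using q_le[of 0 f] by (simp add: F_def)
  \<comment> \<open>At \<open>t = 1\<close> the vector \<open>- v + t v\<close> vanishes, which
    leaves \<open>- p v\<close>.\<close>
  moreover have "q (\<lambda>i. - v i) \<le> - p v"
    using q_le[of 1 "\<lambda>i. - v i"] sublinear_zero[OF p] by (simp add: F_def)
  ultimately show thesis by (rule that)
qed

text \<open>Vectors treated earlier stay linear directions: if \<open>r\<close> lies below
  \<open>q\<close>, then \<open>r (- u) \<le> q (- u) \<le> - q u \<le> - r u\<close>.\<close>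

lemma sublinear_linearize_finite:
  fixes p :: "('i \<Rightarrow> real) \<Rightarrow> real"
  assumes "finite V" "sublinear p"
  shows "\<exists>q. sublinear q \<and> (\<forall>f. q f \<le> p f) \<and> (\<forall>v\<in>V. q (\<lambda>i. - v i) \<le> - q v)"
  using assms(1)
proof (induction V)
  case empty
  then show ?case using assms(2) by auto
next
  case (insert v V)
  then obtain q where q: "sublinear q" "\<And>f. q f \<le> p f" "\<And>u. u \<in> V \<Longrightarrow> q (\<lambda>i. - u i) \<le> - q u"
    by blast
  obtain r where r: "sublinear r" "\<And>f. r f \<le> q f" "r (\<lambda>i. - v i) \<le> - q v"
    using sublinear_linearize[OF q(1), of v] by blast
  have "r (\<lambda>i. - u i) \<le> - r u" if "u \<in> insert v V" for u
  proof (cases "u = v")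
    case True
    then show ?thesis using r(2)[of v] r(3) by simp
  next
    case False
    then have "u \<in> V" using that by simp
    from q(3)[OF this] show ?thesis using r(2)[of "\<lambda>i. - u i"] r(2)[of u] by linarith
  qed
  moreover have "r f \<le> p f" for f using r(2)[of f] q(2)[of f] by simp
  ultimately show ?case using r(1) by blast
qed

text \<open>Linearizing along \<open>x\<close> first pins the value at \<open>x\<close>. Linearizing
  along the unit vectors of \<open>I\<close> afterwards yields a \<open>q\<close> that is linear on
  vectors supported in \<open>I\<close>, and the weights are its values at the unit vectors.\<close>

lemma sublinear_supporting_functional:
  fixes p :: "('i \<Rightarrow> real) \<Rightarrow> real" and x :: "'i \<Rightarrow> real"
  assumes p: "sublinear p" and I: "finite I"
  obtains w where "\<And>f. (\<Sum>i\<in>I. f i * w i) \<le> p (\<lambda>i. if i \<in> I then f i else 0)"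
    and "p (\<lambda>i. if i \<in> I then x i else 0) \<le> (\<Sum>i\<in>I. x i * w i)"
proof -
  define e :: "'i \<Rightarrow> 'i \<Rightarrow> real" where "e j i = (if i = j then 1 else 0)" for i j
  let ?r = "\<lambda>f i. if i \<in> I then f i else (0::real)"
  obtain p' where p': "sublinear p'" "\<And>f. p' f \<le> p f" "p' (\<lambda>i. - ?r x i) \<le> - p (?r x)"
    using sublinear_linearize[OF p, of "?r x"] by blast
  obtain q where q: "sublinear q" "\<And>f. q f \<le> p' f" "\<And>j. j \<in> I \<Longrightarrow> q (\<lambda>i. - e j i) \<le> - q (e j)"
    using sublinear_linearize_finite[of "e ` I" p'] I p'(1) by auto
  have scale: "q (\<lambda>i. a * e j i) \<le> a * q (e j)" if "j \<in> I" for a j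
  proof (cases a "0::real" rule: linorder_cases)
    case less
    then have "q (\<lambda>i. (- a) * (- e j i)) \<le> (- a) * q (\<lambda>i. - e j i)"
      using q(1) sublinear_scale_le[of q "- a" "\<lambda>i. - e j i"] by simp
    also have "\<dots> \<le> (- a) * (- q (e j))"
      using less q(3)[OF that] by (intro mult_left_mono) auto
    finally show ?thesis by simp
  next
    case equal
    then show ?thesis using sublinear_zero[OF q(1)] by simp
  next
    case greater
    then show ?thesis using q(1) by (simp add: sublinear_scale_le)
  qed
  have sum: "q (\<lambda>i. \<Sum>j\<in>J. f j * e j i) \<le> (\<Sum>j\<in>J. f j * q (e j))" if "J \<subseteq> I" for f J
    using finite_subset[OF that I] that
  proof (induction J)
    case empty
    then show ?case using sublinear_zero[OF q(1)] by simp
  next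
    case (insert j J)
    then have "q (\<lambda>i. \<Sum>j\<in>insert j J. f j * e j i) = q (\<lambda>i. f j * e j i + (\<Sum>j\<in>J. f j * e j i))"
      by simp
    also have "\<dots> \<le> q (\<lambda>i. f j * e j i) + q (\<lambda>i. \<Sum>j\<in>J. f j * e j i)"
      by (rule sublinear_add[OF q(1)])
    also have "\<dots> \<le> f j * q (e j) + (\<Sum>j\<in>J. f j * q (e j))"
      using insert scale[of j "f j"] by (intro add_mono) auto
    finally show ?case using insert by simp
  qed
  have expand: "(\<lambda>i. \<Sum>j\<in>I. f j * e j i) = ?r f" for f
    using I by (auto simp: e_def if_distrib cong: if_cong)
  have upper: "q (?r f) \<le> (\<Sum>j\<in>I. f j * q (e j))" for f
    using sum[of I f] expand[of f] by simp
  show thesis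
  proof (rule that[of "\<lambda>j. q (e j)"])
    fix f
    have "- q (?r f) \<le> q (\<lambda>i. - ?r f i)" using sublinear_neg_ge[OF q(1), of "\<lambda>i. - ?r f i"] by simp
    have "(\<lambda>i. - ?r f i) = ?r (\<lambda>i. - f i)" by auto
    \<comment> \<open>Using \<open>upper\<close> at \<open>- f\<close> turns the upper bound on
      \<open>q\<close> into the lower bound needed at \<open>f\<close>.\<close>
    then have "q (\<lambda>i. - ?r f i) \<le> - (\<Sum>j\<in>I. f j * q (e j))"
      using upper[of "\<lambda>i. - f i"] by (simp add: sum_negf)
    with \<open>- q (?r f) \<le> q (\<lambda>i. - ?r f i)\<close> show "(\<Sum>j\<in>I. f j * q (e j)) \<le> p (?r f)"
      using q(2)[of "?r f"] p'(2)[of "?r f"] by linarith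
  next
    have "p (?r x) \<le> - q (\<lambda>i. - ?r x i)" using p'(3) q(2)[of "\<lambda>i. - ?r x i"] by linarith
    also have "\<dots> \<le> q (?r x)" by (rule sublinear_neg_ge[OF q(1)])
    also have "\<dots> \<le> (\<Sum>j\<in>I. x j * q (e j))" by (rule upper)
    finally show "p (?r x) \<le> (\<Sum>j\<in>I. x j * q (e j))" .
  qed
qed

section \<open>Duality for symmetric norms\<close>

text \<open>When \<open>a\<close> is a sorted vector, the prefix sums are its top norms and the
  differences of \<open>b\<close> are their coefficients.\<close>

lemma sum_by_parts:
  fixes a b :: "nat \<Rightarrow> real"
  shows "(\<Sum>i<n. a i * b i) = (\<Sum>k<n. (b k - b (Suc k)) * (\<Sum>i<Suc k. a i)) + b n * (\<Sum>i<n. a i)"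
  by (induction n) (simp_all add: algebra_simps)

text \<open>After summation by parts the prefix sums carry the nonnegative weights
  \<open>s k - s (Suc k)\<close> and \<open>s n\<close>.\<close>

lemma sum_mult_mono_prefix:
  fixes a b s :: "nat \<Rightarrow> real"
  assumes "antimono s" "\<And>i. 0 \<le> s i"
    and "\<And>k. k \<le> n \<Longrightarrow> (\<Sum>i<k. a i) \<le> (\<Sum>i<k. b i)"
  shows "(\<Sum>i<n. a i * s i) \<le> (\<Sum>i<n. b i * s i)"
  unfolding sum_by_parts[of _ s]
proof (intro add_mono sum_mono)
  show "s n * (\<Sum>i<n. a i) \<le> s n * (\<Sum>i<n. b i)"
    using assms(2,3) by (intro mult_left_mono) auto
next
  fix k assume "k \<in> {..<n}"
  then show "(s k - s (Suc k)) * (\<Sum>i<Suc k. a i) \<le> (s k - s (Suc k)) * (\<Sum>i<Suc k. b i)"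
    using assms(1) assms(3)[of "Suc k"] by (intro mult_left_mono) (auto simp: antimono_def)
qed

text \<open>The induction removes the largest element of \<open>A\<close>. It is at least
  \<open>card A - 1\<close>, so \<open>b\<close> there is at most the last term of the prefix
  sum.\<close>

lemma sum_le_sum_prefix:
  fixes b :: "nat \<Rightarrow> real"
  assumes "antimono b" "finite A"
  shows "sum b A \<le> (\<Sum>i<card A. b i)"
  using assms(2)
proof (induction "card A" arbitrary: A)
  case 0
  then show ?case by simp
next
  case (Suc k)
  then have ne: "A \<noteq> {}" by auto
  let ?M = "Max A"
  have M: "?M \<in> A" using Suc ne by simp
  have "A \<subseteq> {..?M}" using Suc by auto
  then have "card A \<le> Suc ?M" by (metis card_atMost card_mono finite_atMost)
  then have "b ?M \<le> b k" using Suc assms(1) by (auto simp: antimono_def)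
  moreover have "sum b (A - {?M}) \<le> (\<Sum>i<card (A - {?M}). b i)"
    using Suc M by (intro Suc.hyps(1)) auto
  moreover have "card (A - {?M}) = k" using Suc M by simp
  moreover have "sum b A = b ?M + sum b (A - {?M})" using Suc M by (simp add: sum.remove)
  moreover have "card A = Suc k" using Suc by simp
  ultimately show ?case by simp
qed

text \<open>Averages of initial segments are nonincreasing, stated without division. In the
  induction step, \<open>s k\<close> is at most each of the first \<open>r\<close> terms.\<close>

lemma prefix_average_antimono:
  fixes s :: "nat \<Rightarrow> real"
  assumes "antimono s" "r \<le> k"
  shows "real r * (\<Sum>i<k. s i) \<le> real k * (\<Sum>i<r. s i)"
  using assms(2)
proof (induction k rule: dec_induct)
  case (step k)
  have "real r * s k \<le> (\<Sum>i<r. s i)"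
    using sum_bounded_below[of "{..<r}" "s k" s] step assms(1) by (simp add: antimono_def)
  then show ?case using step by (simp add: algebra_simps)
qed simp

text \<open>Take a supporting functional \<open>w\<close> of the norm at the sorted \<open>x\<close>
  and let \<open>y\<close> be the decreasing rearrangement of \<open>w\<close>. Sorting can only
  increase the pairing with the sorted \<open>x\<close>. The dual ball is not left, because pairing
  the sorted \<open>z\<close> with \<open>y\<close> equals pairing a signed permutation of it with
  \<open>w\<close>.\<close>

lemma symmetric_norm_dual:
  assumes N: "symmetric_norm_on d N" and x: "x \<in> carrier_vec d"
  obtains y where "antimono y" "\<And>i. 0 \<le> y i" "\<And>i. d \<le> i \<Longrightarrow> y i = 0"
    and "N x \<le> (\<Sum>i<d. decr_coord x i * y i)"
    and "\<And>z. z \<in> carrier_vec d \<Longrightarrow> (\<Sum>i<d. decr_coord z i * y i) \<le> N z"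
proof -
  define p where "p f = N (vec d f)" for f
  have p_restrict: "p (\<lambda>i. if i \<in> {..<d} then f i else 0) = p f" for f
    unfolding p_def by (rule arg_cong[of _ _ N]) auto
  have "sublinear p"
    unfolding sublinear_def
  proof (intro conjI allI impI)
    fix f g :: "nat \<Rightarrow> real"
    have "vec d (\<lambda>i. f i + g i) = vec d f + vec d g" by auto
    then show "p (\<lambda>i. f i + g i) \<le> p f + p g"
      using symmetric_norm_triangle[OF N, of "vec d f" "vec d g"] by (simp add: p_def)
  next
    fix a :: real and f :: "nat \<Rightarrow> real" assume "0 < a"
    have "vec d (\<lambda>i. a * f i) = a \<cdot>\<^sub>v vec d f" by auto
    then show "p (\<lambda>i. a * f i) \<le> a * p f"
      using symmetric_norm_scale[OF N, of "vec d f" a] \<open>0 < a\<close> by (simp add: p_def)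
  qed
  then obtain w where w_le: "\<And>f. (\<Sum>i<d. f i * w i) \<le> p f"
    and w_ge: "p (decr_coord x) \<le> (\<Sum>i<d. decr_coord x i * w i)"
    using sublinear_supporting_functional[of p "{..<d}" "decr_coord x"] unfolding p_restrict by auto
  define y where "y = decr_coord (vec d w)"
  obtain \<pi> where \<pi>: "\<pi> permutes {..<d}"
    and y: "\<And>i. i < d \<Longrightarrow> y i = \<bar>w (\<pi> i)\<bar>"
  proof -
    obtain \<pi> where "\<pi> permutes {..<dim_vec (vec d w)}"
      and "\<And>i. i < dim_vec (vec d w) \<Longrightarrow> decreasing_rearrangement (vec d w) $ i = \<bar>vec d w $ \<pi> i\<bar>"
      using decreasing_rearrangement_permutation by blast
    moreover from this(1) have "\<pi> i < d" if "i < d" for i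
      using that permutes_in_image[of \<pi> "{..<d}" i] by simp
    ultimately show thesis by (intro that[of \<pi>]) (auto simp: y_def decr_coord_def)
  qed
  let ?\<sigma> = "inv_into UNIV \<pi>"
  have \<sigma>: "?\<sigma> permutes {..<d}" using \<pi> by (rule permutes_inv)
  have abs_w: "\<bar>w i\<bar> = y (?\<sigma> i)" if "i < d" for i
  proof -
    have "?\<sigma> i < d" using permutes_in_image[OF \<sigma>, of i] that by simp
    then show ?thesis using y[of "?\<sigma> i"] permutes_inverses(1)[OF \<pi>] by simp
  qed
  show thesis
  proof (rule that[of y])
    show anti: "antimono y" unfolding y_def by (rule decr_coord_antimono)
    show "0 \<le> y i" for i unfolding y_def by (rule decr_coord_nonneg)
    show "y i = 0" if "d \<le> i" for i unfolding y_def by (rule decr_coord_eq_0) (simp add: that)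
    show "N x \<le> (\<Sum>i<d. decr_coord x i * y i)"
    proof -
      \<comment> \<open>The first \<open>k\<close> absolute values of \<open>w\<close> are the
        values of \<open>y\<close> on a set of \<open>k\<close> indices, so their sum is at most
        that of the \<open>k\<close> largest.\<close>
      have prefix: "(\<Sum>i<k. \<bar>w i\<bar>) \<le> (\<Sum>i<k. y i)" if "k \<le> d" for k
      proof -
        have "(\<Sum>i<k. \<bar>w i\<bar>) = sum y (?\<sigma> ` {..<k})"
          using that abs_w by (subst sum.reindex) (auto intro: inj_on_subset[OF permutes_inj[OF \<sigma>]])
        also have "\<dots> \<le> (\<Sum>i<card (?\<sigma> ` {..<k}). y i)"
          by (intro sum_le_sum_prefix anti) auto
        also have "card (?\<sigma> ` {..<k}) = k"
          by (subst card_image) (auto intro: inj_on_subset[OF permutes_inj[OF \<sigma>]])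
        finally show ?thesis .
      qed
      have "N x = p (decr_coord x)" using norm_decr_coord[OF N x] by (simp add: p_def)
      also note w_ge
      also have "(\<Sum>i<d. decr_coord x i * w i) \<le> (\<Sum>i<d. \<bar>w i\<bar> * decr_coord x i)"
        using decr_coord_nonneg[of x] by (intro sum_mono) (simp add: mult.commute[of _ "decr_coord x _"] mult_left_mono)
      also have "\<dots> \<le> (\<Sum>i<d. y i * decr_coord x i)"
        using prefix decr_coord_antimono[of x] decr_coord_nonneg[of x]
        by (intro sum_mult_mono_prefix) auto
      finally show ?thesis by (simp add: mult.commute)
    qed
    show "(\<Sum>i<d. decr_coord z i * y i) \<le> N z" if z: "z \<in> carrier_vec d" for z
    proof -
      \<comment> \<open>The sorted \<open>z\<close>, moved to the positions of \<open>w\<close> and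
        given its signs, so that every product \<open>f j * w j\<close> is nonnegative.\<close>
      define f where "f j = (if 0 \<le> w j then 1 else -1) * decr_coord z (?\<sigma> j)" for j
      have "(\<Sum>i<d. decr_coord z i * y i) = (\<Sum>j<d. decr_coord z (?\<sigma> j) * y (?\<sigma> j))"
        using sum.permute[OF \<sigma>, of "\<lambda>i. decr_coord z i * y i"] by (simp add: o_def)
      also have "\<dots> = (\<Sum>j<d. f j * w j)"
        by (intro sum.cong) (auto simp: f_def simp flip: abs_w)
      also have "\<dots> \<le> N (vec d f)" using w_le by (simp add: p_def)
      also have "\<dots> = N (vec d (decr_coord z))"
      proof (rule norm_permute_signs[OF N _ \<sigma>])
        show "\<bar>f i\<bar> = \<bar>vec d (decr_coord z) $ ?\<sigma> i\<bar>" if "i < d" for i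
          using permutes_in_image[OF \<sigma>, of i] that by (simp add: f_def abs_mult)
      qed simp
      also have "\<dots> = N z" by (rule norm_decr_coord[OF N z])
      finally show ?thesis .
    qed
  qed
qed

lemma symmetric_norm_ge_max_coord:
  assumes N: "symmetric_norm_on d N" and x: "x \<in> carrier_vec d"
  shows "decr_coord x 0 * N (unit_vec d 0) \<le> N x"
proof -
  let ?u = "vec d (decr_coord x)"
  let ?v = "vec d (\<lambda>i. if i = 0 then decr_coord x i else - decr_coord x i)"
  \<comment> \<open>flipping signs does not change the norm, and the two vectors add up to a multiple of a unit vector\<close>
  have "N ?v = N ?u"
    by (rule norm_permute_signs[OF N _ permutes_id]) auto
  have "?u + ?v = (2 * decr_coord x 0) \<cdot>\<^sub>v unit_vec d 0" by (auto simp: unit_vec_def)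
  then have "2 * decr_coord x 0 * N (unit_vec d 0) = N (?u + ?v)"
    using symmetric_norm_scale[OF N, of "unit_vec d 0" "2 * decr_coord x 0"] decr_coord_nonneg[of x 0]
    by simp
  also have "\<dots> \<le> N ?u + N ?v"
    by (rule symmetric_norm_triangle[OF N]) auto
  finally show ?thesis using norm_decr_coord[OF N x] \<open>N ?v = N ?u\<close> by simp
qed

text \<open>The entry 1 occurs somewhere, hence by monotonicity at index 0. Testing a dual vector
  \<open>y\<close> against the unit vector thus bounds \<open>y 0\<close>.\<close>

lemma decr_coord_unit_vec:
  assumes "0 < d"
  shows "decr_coord (unit_vec d 0) i = (if i = 0 then 1 else 0)"
proof -
  obtain \<pi> where \<pi>: "\<pi> permutes {..<d}"
    and s: "\<And>i. i < d \<Longrightarrow> decr_coord (unit_vec d 0) i = \<bar>unit_vec d 0 $ \<pi> i :: real\<bar>"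
    using decreasing_rearrangement_permutation[of "unit_vec d 0"]
    by (metis (no_types, lifting) decr_coord_def index_unit_vec(3))
  have lt: "\<pi> i < d" if "i < d" for i using permutes_in_image[OF \<pi>, of i] that by simp
  have s': "decr_coord (unit_vec d 0) i = (if \<pi> i = 0 then 1 else 0)" if "i < d" for i
    using s[OF that] lt[OF that] assms by (simp add: unit_vec_def)
  have "inv_into UNIV \<pi> 0 < d" using permutes_in_image[OF permutes_inv[OF \<pi>], of 0] assms by simp
  then have "decr_coord (unit_vec d 0) (inv_into UNIV \<pi> 0) = 1"
    using s'[of "inv_into UNIV \<pi> 0"] permutes_inverses(1)[OF \<pi>] by simp
  then have "1 \<le> decr_coord (unit_vec d 0) 0"
    using decr_coord_antimono[of "unit_vec d 0"] by (metis antimonoD le0)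
  then have "\<pi> 0 = 0" using s'[of 0] assms by (auto split: if_splits)
  then have "\<pi> i \<noteq> 0" if "i \<noteq> 0" for i
    using that permutes_inj[OF \<pi>] by (metis injD)
  then show ?thesis
    using s'[of i] \<open>\<pi> 0 = 0\<close> assms
    by (cases "i < d"; cases "i = 0") (auto simp: decr_coord_eq_0)
qed

section \<open>Rounding positions and values\<close>

text \<open>Positions are 0-based, hence \<open>Suc i\<close>: block \<open>j > 0\<close> holds the
  \<open>i\<close> with \<open>(1 + e) ^ (j - 1) < i + 1 \<le> (1 + e) ^ j\<close>.\<close>

definition block :: "real \<Rightarrow> nat \<Rightarrow> nat" where
  "block e i = (LEAST j. real (Suc i) \<le> (1 + e) ^ j)"

text \<open>The last 0-based position in blocks up to \<open>j\<close>. For \<open>e > 0\<close> the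
  floor is at least 1, so the subtraction is not truncated.\<close>

definition block_end :: "real \<Rightarrow> nat \<Rightarrow> nat" where
  "block_end e j = nat \<lfloor>(1 + e) ^ j\<rfloor> - 1"

lemma block_le: "real (Suc i) \<le> (1 + e) ^ j \<Longrightarrow> block e i \<le> j"
  unfolding block_def by (rule Least_le)

lemma block_ge:
  assumes "0 < e" shows "real (Suc i) \<le> (1 + e) ^ block e i"
  unfolding block_def
proof (rule LeastI_ex)
  show "\<exists>j. real (Suc i) \<le> (1 + e) ^ j"
    using real_arch_pow[of "1 + e" "real (Suc i)"] assms by (auto intro: less_imp_le)
qed

lemma block_mono: "0 < e \<Longrightarrow> i \<le> j \<Longrightarrow> block e i \<le> block e j"
  using block_ge[of e j] by (intro block_le) simp

lemma le_block_end: "0 < e \<Longrightarrow> i \<le> block_end e (block e i)"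
  using block_ge[of e i] by (simp add: block_end_def le_nat_iff le_floor_iff le_diff_conv2)

lemma block_end_mono: "0 < e \<Longrightarrow> i \<le> j \<Longrightarrow> block_end e i \<le> block_end e j"
  unfolding block_end_def by (intro diff_le_mono nat_mono floor_mono power_increasing) auto

text \<open>Let \<open>r\<close> be the largest block boundary \<open>F j\<close> that is at most
  \<open>k\<close>. The next boundary exceeds \<open>k\<close> but is at most
  \<open>(1 + e) * (1 + e) ^ j\<close>, which is close to \<open>(1 + e) * r\<close>.\<close>

lemma block_rounding:
  assumes "0 < e" "1 \<le> k"
  obtains r where "r \<le> k" "real k \<le> (1 + 2 * e) * real r"
    and "\<And>i. i < r \<Longrightarrow> block_end e (block e i) < k"
proof -
  define F where "F j = nat \<lfloor>(1 + e) ^ j\<rfloor>" for j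
  have F_le: "real (F j) \<le> (1 + e) ^ j" and F_gt: "(1 + e) ^ j < real (F j) + 1" for j
    using assms by (simp_all add: F_def)
  have "\<exists>j. k < F j"
  proof -
    obtain j where "real (Suc k) < (1 + e) ^ j"
      using real_arch_pow[of "1 + e" "real (Suc k)"] assms by auto
    then show ?thesis using F_gt[of j] by (intro exI[of _ j]) simp
  qed
  then have least: "k < F (LEAST j. k < F j)" by (rule LeastI_ex)
  have "(LEAST j. k < F j) \<noteq> 0"
  proof
    assume "(LEAST j. k < F j) = 0"
    then have "k < F 0" using least by simp
    then show False using assms by (simp add: F_def)
  qed
  then obtain j where j: "(LEAST j. k < F j) = Suc j" using not0_implies_Suc by blast
  have "\<not> k < F j" using j by (intro not_less_Least) simp
  have "k < F (Suc j)" using least j by simp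
  have F_pos: "1 \<le> real (F j)" 
  proof -
    have "1 \<le> (1 + e) ^ j" using assms by (intro one_le_power) simp
    then have "0 < F j" using F_gt[of j] by (cases "F j") auto
    then show ?thesis by simp
  qed
  show thesis
  proof (rule that[of "F j"])
    show "F j \<le> k" using \<open>\<not> k < F j\<close> by simp
    \<comment> \<open>The 1 gained from integrality cancels the 1 from the floor; the remaining
      \<open>e\<close> is absorbed by \<open>e * r\<close> since \<open>r \<ge> 1\<close>, giving
      \<open>1 + 2 * e\<close>.\<close>
    have "real k + 1 \<le> real (F (Suc j))" using \<open>k < F (Suc j)\<close> by simp
    also have "\<dots> \<le> (1 + e) * (1 + e) ^ j" using F_le[of "Suc j"] by simp
    also have "\<dots> \<le> (1 + e) * (real (F j) + 1)"
      using F_gt[of j] assms by (intro mult_left_mono) auto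
    also have "\<dots> = (1 + e) * real (F j) + e * 1 + 1" by (simp add: algebra_simps)
    also have "\<dots> \<le> (1 + e) * real (F j) + e * real (F j) + 1"
      using F_pos assms by (intro add_mono mult_left_mono) auto
    finally show "real k \<le> (1 + 2 * e) * real (F j)" by (simp add: algebra_simps)
    show "block_end e (block e i) < k" if "i < F j" for i
    proof -
      have "real (Suc i) \<le> (1 + e) ^ j" using that F_le[of j] by linarith
      then have "block_end e (block e i) \<le> block_end e j"
        using assms by (intro block_end_mono block_le) auto
      also have "\<dots> < F j" using F_pos by (simp add: block_end_def F_def)
      finally show ?thesis using \<open>F j \<le> k\<close> by simp
    qed
  qed
qed

lemma sum_telescope_from:
  fixes y :: "nat \<Rightarrow> real"
  shows "(\<Sum>k<n. if m \<le> k then y k - y (Suc k) else 0) = (if m \<le> n then y m - y n else 0)"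
  by (induction n) (auto simp: le_Suc_eq)

text \<open>\<open>y\<close> is a combination of indicators of initial segments with weights
  \<open>c k \<ge> 0\<close>, so it suffices to treat one segment. Rounding keeps at least its first
  \<open>r\<close> positions, and the comparison of averages bounds the loss by
  \<open>1 + 2 * e\<close>.\<close>

lemma sum_le_sum_block_end:
  fixes s y :: "nat \<Rightarrow> real"
  assumes s: "antimono s" "\<And>i. 0 \<le> s i" and y: "antimono y" "\<And>i. d \<le> i \<Longrightarrow> y i = 0" and e: "0 < e"
  shows "(\<Sum>i<d. s i * y i) \<le> (1 + 2 * e) * (\<Sum>i<d. s i * y (block_end e (block e i)))"
proof -
  let ?\<phi> = "\<lambda>i. block_end e (block e i)"
  define c where "c k = y k - y (Suc k)" for k
  have c: "0 \<le> c k" for k using y(1) by (simp add: c_def antimono_def)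
  have y_eq: "y m = (\<Sum>k<d. if m \<le> k then c k else 0)" for m
    unfolding c_def sum_telescope_from using y(2)[of d] y(2)[of m] by simp
  have prefix: "(\<Sum>i<Suc k. s i) \<le> (1 + 2 * e) * (\<Sum>i<d. if ?\<phi> i \<le> k then s i else 0)" if "k < d" for k
  proof -
    obtain r where r: "r \<le> Suc k" "real (Suc k) \<le> (1 + 2 * e) * real r"
      "\<And>i. i < r \<Longrightarrow> ?\<phi> i < Suc k"
      using block_rounding[OF e, of "Suc k"] by auto
    have "0 < r" using r(2) by (cases r) auto
    have "real r * (\<Sum>i<Suc k. s i) \<le> real (Suc k) * (\<Sum>i<r. s i)"
      using s(1) r(1) by (rule prefix_average_antimono)
    also have "\<dots> \<le> ((1 + 2 * e) * real r) * (\<Sum>i<r. s i)"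
      using r(2) s(2) by (intro mult_right_mono sum_nonneg) auto
    finally have "(\<Sum>i<Suc k. s i) \<le> (1 + 2 * e) * (\<Sum>i<r. s i)"
      using \<open>0 < r\<close> by (simp add: mult.assoc mult.left_commute[of _ "real r"] del: sum.lessThan_Suc)
    also have "(\<Sum>i<r. s i) = (\<Sum>i<r. if ?\<phi> i \<le> k then s i else 0)"
      using r(3) by (intro sum.cong) (auto simp: less_Suc_eq_le)
    also have "\<dots> \<le> (\<Sum>i<d. if ?\<phi> i \<le> k then s i else 0)"
      using r(1) that s(2) by (intro sum_mono2) auto
    finally show ?thesis using e by (simp add: mult_left_mono)
  qed
  have "(\<Sum>i<d. s i * y i) = (\<Sum>k<d. c k * (\<Sum>i<Suc k. s i))"
    unfolding sum_by_parts[of s y] using y(2)[of d] by (simp add: c_def)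
  also have "\<dots> \<le> (\<Sum>k<d. c k * ((1 + 2 * e) * (\<Sum>i<d. if ?\<phi> i \<le> k then s i else 0)))"
    using prefix c by (intro sum_mono mult_left_mono) auto
  also have "\<dots> = (1 + 2 * e) * (\<Sum>k<d. \<Sum>i<d. s i * (if ?\<phi> i \<le> k then c k else 0))"
    by (simp add: sum_distrib_left if_distrib mult_ac cong: if_cong)
  also have "(\<Sum>k<d. \<Sum>i<d. s i * (if ?\<phi> i \<le> k then c k else 0)) = (\<Sum>i<d. s i * y (?\<phi> i))"
    by (subst sum.swap) (simp add: y_eq sum_distrib_left)
  finally show ?thesis .
qed

text \<open>A geometric scale with cutoff. Index \<open>Suc L\<close> gives the value 0, so every
  \<open>v \<ge> 0\<close> can be rounded down using indices up to \<open>Suc L\<close>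
  only.\<close>

definition level :: "real \<Rightarrow> real \<Rightarrow> nat \<Rightarrow> nat \<Rightarrow> real" where
  "level a e L l = (if l \<le> L then a / (1 + e) ^ l else 0)"

definition level_of :: "real \<Rightarrow> real \<Rightarrow> nat \<Rightarrow> real \<Rightarrow> nat" where
  "level_of a e L v = (LEAST l. level a e L l \<le> v)"

lemma level_level_of_le: "0 \<le> v \<Longrightarrow> level a e L (level_of a e L v) \<le> v"
  unfolding level_of_def by (rule LeastI[of _ "Suc L"]) (simp add: level_def)

lemma level_of_le: "0 \<le> v \<Longrightarrow> level_of a e L v \<le> Suc L"
  unfolding level_of_def by (rule Least_le) (simp add: level_def)

lemma level_of_antimono: "0 \<le> v \<Longrightarrow> v \<le> u \<Longrightarrow> level_of a e L u \<le> level_of a e L v"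
  unfolding level_of_def[of a e L u] using level_level_of_le[of v a e L] by (intro Least_le) simp

lemma level_nonneg: "0 \<le> a \<Longrightarrow> 0 \<le> e \<Longrightarrow> 0 \<le> level a e L l"
  by (simp add: level_def)

lemma level_antimono:
  assumes "0 \<le> a" "0 \<le> e" "k \<le> l" shows "level a e L l \<le> level a e L k"
  using assms by (auto simp: level_def intro!: divide_left_mono power_increasing mult_pos_pos)

text \<open>By minimality \<open>v\<close> lies below the preceding level. That level is
  \<open>1 + e\<close> times the chosen one, unless the chosen level is 0; then it is the additive
  term.\<close>

lemma le_level_level_of:
  assumes "0 \<le> a" "0 < e" "0 \<le> v" "v \<le> a"
  shows "v \<le> (1 + e) * level a e L (level_of a e L v) + a / (1 + e) ^ L"
proof (cases "level_of a e L v")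
  case 0
  have "v \<le> (1 + e) * a" using assms mult_right_mono[of 1 "1 + e" a] by simp
  then show ?thesis using assms 0 by (simp add: level_def add_increasing2)
next
  case (Suc l)
  then have lt: "v < level a e L l"
    using not_less_Least[of l "\<lambda>l. level a e L l \<le> v"] by (simp add: level_of_def)
  then have "l \<le> L" using assms by (auto simp: level_def split: if_splits)
  show ?thesis
  proof (cases "l = L")
    case True
    then show ?thesis using lt assms level_nonneg[of a e L "Suc l"] Suc
      by (simp add: level_def)
  next
    case False
    then have "level a e L l = (1 + e) * level a e L (Suc l)"
      using \<open>l \<le> L\<close> assms by (simp add: level_def)
    moreover have "0 \<le> a / (1 + e) ^ L" using assms by simp
    ultimately show ?thesis using lt Suc by simp
  qed
qed

text \<open>A nondecreasing \<open>h\<close> is recovered from the set of values \<open>h j + j\<close>, which are strictly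
  increasing in \<open>j\<close>; so there are at most as many such \<open>h\<close> as subsets of the range of \<open>h j + j\<close>.\<close>

definition decode :: "nat set \<Rightarrow> nat \<Rightarrow> nat" where
  "decode A j = sorted_list_of_set A ! j - j"

lemma decode_image:
  assumes mono: "\<And>i j. i \<le> j \<Longrightarrow> h i \<le> h j" and "j < m"
  shows "decode ((\<lambda>j. h j + j) ` {..<m}) j = h j"
proof -
  let ?xs = "map (\<lambda>j. h j + j) [0..<m]"
  have less: "h i + i < h j + j" if "i < j" for i j using mono[of i j] that by simp
  have "sorted_wrt (<) ?xs"
    by (rule sorted_wrt_map_mono[OF sorted_wrt_upt]) (use less in auto)
  moreover have "set ?xs = (\<lambda>j. h j + j) ` {..<m}" by (simp add: atLeast0LessThan)
  ultimately have "sorted_list_of_set ((\<lambda>j. h j + j) ` {..<m}) = ?xs"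
    by (metis strict_sorted_iff sorted_list_of_set.idem_if_sorted_distinct)
  then show ?thesis using \<open>j < m\<close> by (simp add: decode_def)
qed

section \<open>The net\<close>

text \<open>The nonincreasing nonnegative part of the dual unit ball. For such \<open>y\<close> the
  sorted vectors are the extremal test vectors, so for a symmetric norm testing only them loses
  nothing.\<close>

definition sorted_dual_ball :: "nat \<Rightarrow> (real vec \<Rightarrow> real) \<Rightarrow> (nat \<Rightarrow> real) set" where
  "sorted_dual_ball d N = {y. antimono y \<and> (\<forall>i. 0 \<le> y i) \<and> (\<forall>i\<ge>d. y i = 0) \<and>
     (\<forall>z\<in>carrier_vec d. (\<Sum>i<d. decr_coord z i * y i) \<le> N z)}"

text \<open>\<open>A\<close> encodes the level index of each block; a larger index means a smaller
  value.\<close>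

definition net_point :: "nat \<Rightarrow> real \<Rightarrow> real \<Rightarrow> nat \<Rightarrow> nat set \<Rightarrow> nat \<Rightarrow> real" where
  "net_point d a e L A i = (if i < d then level a e L (decode A (block e i)) else 0)"

text \<open>Both roundings only decrease \<open>y\<close>, so the result stays in the dual ball. The
  factor \<open>1 + 2 * e\<close> comes from positions, \<open>1 + e\<close> from levels, and
  \<open>e * N x\<close> from the cutoff. \<open>M\<close> bounds the block indices and
  \<open>L\<close> puts the cutoff at \<open>e / d\<close> times the largest level or lower.\<close>

lemma symmetric_norm_net_point:
  assumes N: "symmetric_norm_on d N" and d: "0 < d" and e: "0 < e"
    and M: "real d \<le> (1 + e) ^ M" and L: "real d / e \<le> (1 + e) ^ L" and x: "x \<in> carrier_vec d"
  obtains A where "A \<subseteq> {..<L + M + 2}" "net_point d (N (unit_vec d 0)) e L A \<in> sorted_dual_ball d N"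
    and "N x \<le> (1 + 2 * e) *
      ((1 + e) * (\<Sum>i<d. decr_coord x i * net_point d (N (unit_vec d 0)) e L A i) + e * N x)"
proof -
  define a where "a = N (unit_vec d 0)"
  have a: "0 \<le> a" unfolding a_def by (rule symmetric_norm_nonneg[OF N]) simp
  obtain y where y: "antimono y" "\<And>i. 0 \<le> y i" "\<And>i. d \<le> i \<Longrightarrow> y i = 0"
    and y_ge: "N x \<le> (\<Sum>i<d. decr_coord x i * y i)"
    and y_le: "\<And>z. z \<in> carrier_vec d \<Longrightarrow> (\<Sum>i<d. decr_coord z i * y i) \<le> N z"
    using symmetric_norm_dual[OF N x] by blast
  have y_le_a: "y i \<le> a" for i
  proof -
    have "(\<Sum>i<d. decr_coord (unit_vec d 0) i * y i) = (\<Sum>i<d. if i = 0 then y i else 0)"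
      using decr_coord_unit_vec[OF d] by (intro sum.cong) auto
    also have "\<dots> = y 0" using d by simp
    finally have "y 0 \<le> a" using y_le[of "unit_vec d 0"] by (simp add: a_def)
    then show ?thesis using antimonoD[OF y(1), of 0 i] by simp
  qed
  let ?\<phi> = "\<lambda>i. block_end e (block e i)"
  define h where "h j = level_of a e L (y (block_end e j))" for j
  have h_mono: "h i \<le> h j" if "i \<le> j" for i j
    unfolding h_def using antimonoD[OF y(1) block_end_mono[OF e that]] y(2)
    by (intro level_of_antimono) auto
  define A where "A = (\<lambda>j. h j + j) ` {..<Suc M}"
  have block_lt: "block e i < Suc M" if "i < d" for i
    using that M by (intro le_imp_less_Suc block_le) linarith
  define u where "u = net_point d a e L A"
  have u: "u i = level a e L (level_of a e L (y (?\<phi> i)))" if "i < d" for i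
    using that decode_image[of h "block e i" "Suc M"] h_mono block_lt[OF that]
    by (simp add: u_def net_point_def A_def h_def)
  have u_nonneg: "0 \<le> u i" for i
    using a e by (simp add: u_def net_point_def level_nonneg)
  have u_le_y: "u i \<le> y i" for i
  proof (cases "i < d")
    case True
    have "u i \<le> y (?\<phi> i)" unfolding u[OF True] using y(2) by (rule level_level_of_le)
    also have "\<dots> \<le> y i" using y(1) le_block_end[OF e] by (rule antimonoD)
    finally show ?thesis .
  next
    case False
    then show ?thesis using y(2)[of i] by (simp add: u_def net_point_def)
  qed
  have "antimono u"
  proof (rule antimonoI)
    fix i j :: nat assume "i \<le> j"
    show "u j \<le> u i"
    proof (cases "j < d")
      case True
      have "y (?\<phi> j) \<le> y (?\<phi> i)"
        using y(1) block_end_mono[OF e block_mono[OF e \<open>i \<le> j\<close>]] by (rule antimonoD)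
      then have "level a e L (level_of a e L (y (?\<phi> j))) \<le> level a e L (level_of a e L (y (?\<phi> i)))"
        using a e y(2) by (intro level_antimono level_of_antimono) auto
      then show ?thesis using True \<open>i \<le> j\<close> by (simp add: u)
    next
      case False
      then show ?thesis using u_nonneg[of i] by (simp add: u_def net_point_def)
    qed
  qed
  moreover have "(\<Sum>i<d. decr_coord z i * u i) \<le> N z" if "z \<in> carrier_vec d" for z
  proof -
    have "(\<Sum>i<d. decr_coord z i * u i) \<le> (\<Sum>i<d. decr_coord z i * y i)"
      using u_le_y decr_coord_nonneg by (intro sum_mono mult_left_mono) auto
    then show ?thesis using y_le[OF that] by simp
  qed
  ultimately have "u \<in> sorted_dual_ball d N"
    using u_nonneg by (auto simp: sorted_dual_ball_def u_def net_point_def)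
  moreover have "A \<subseteq> {..<L + M + 2}"
  proof -
    have "h j \<le> Suc L" for j unfolding h_def using y(2) by (rule level_of_le)
    then have "h j + j < L + M + 2" if "j < Suc M" for j
      using add_le_less_mono[of "h j" "Suc L" j "Suc M"] that by simp
    then show ?thesis by (auto simp: A_def)
  qed
  moreover have "N x \<le> (1 + 2 * e) * ((1 + e) * (\<Sum>i<d. decr_coord x i * u i) + e * N x)"
  proof -
    let ?s = "decr_coord x"
    \<comment> \<open>Each of the \<open>d\<close> coordinates is at most \<open>?s 0\<close>, the
      cutoff value is at most \<open>e * a / d\<close>, and
      \<open>?s 0 * a \<le> N x\<close>.\<close>
    have "(\<Sum>i<d. ?s i * (a / (1 + e) ^ L)) \<le> e * N x"
    proof -
      have "(\<Sum>i<d. ?s i) \<le> real d * ?s 0"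
        using sum_bounded_above[of "{..<d}" ?s "?s 0"] decr_coord_antimono[of x]
        by (simp add: antimono_def)
      then have "(\<Sum>i<d. ?s i) * (a / (1 + e) ^ L) \<le> (real d * ?s 0) * (a / (1 + e) ^ L)"
        using a e by (intro mult_right_mono) auto
      also have "\<dots> = (real d / (1 + e) ^ L) * (?s 0 * a)" by simp
      also have "\<dots> \<le> e * (?s 0 * a)"
        using L e a decr_coord_nonneg[of x 0]
        by (intro mult_right_mono) (auto simp: field_simps)
      also have "\<dots> \<le> e * N x"
        using symmetric_norm_ge_max_coord[OF N x] e by (intro mult_left_mono) (auto simp: a_def)
      finally show ?thesis by (simp only: sum_distrib_right)
    qed
    moreover have "(\<Sum>i<d. ?s i * y (?\<phi> i)) \<le> (\<Sum>i<d. ?s i * ((1 + e) * u i + a / (1 + e) ^ L))"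
      using le_level_level_of[OF a e y(2) y_le_a] decr_coord_nonneg[of x]
      by (intro sum_mono mult_left_mono) (auto simp: u)
    moreover have "(\<Sum>i<d. ?s i * ((1 + e) * u i + a / (1 + e) ^ L)) =
        (1 + e) * (\<Sum>i<d. ?s i * u i) + (\<Sum>i<d. ?s i * (a / (1 + e) ^ L))"
      by (simp add: distrib_left[of "?s _"] sum.distrib sum_distrib_left mult.left_commute)
    ultimately have "(\<Sum>i<d. ?s i * y (?\<phi> i)) \<le> (1 + e) * (\<Sum>i<d. ?s i * u i) + e * N x"
      by linarith
    then have "(1 + 2 * e) * (\<Sum>i<d. ?s i * y (?\<phi> i)) \<le>
        (1 + 2 * e) * ((1 + e) * (\<Sum>i<d. ?s i * u i) + e * N x)"
      using e by (intro mult_left_mono) auto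
    moreover have "(\<Sum>i<d. ?s i * y i) \<le> (1 + 2 * e) * (\<Sum>i<d. ?s i * y (?\<phi> i))"
      using decr_coord_antimono decr_coord_nonneg y(1,3) e by (rule sum_le_sum_block_end)
    ultimately show ?thesis using y_ge by linarith
  qed
  ultimately show thesis using that[of A] by (simp add: u_def a_def)
qed

lemma symmetric_norm_net:
  assumes N: "symmetric_norm_on d N" and d: "0 < d" and e: "0 < e"
    and M: "real d \<le> (1 + e) ^ M" and L: "real d / e \<le> (1 + e) ^ L"
  obtains Y where "Y \<subseteq> sorted_dual_ball d N" "finite Y" "Y \<noteq> {}" "card Y \<le> 2 ^ (L + M + 2)"
    and "\<And>x. x \<in> carrier_vec d \<Longrightarrow> \<exists>y\<in>Y.
      N x \<le> (1 + 2 * e) * ((1 + e) * (\<Sum>i<d. decr_coord x i * y i) + e * N x)"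
proof -
  let ?net = "net_point d (N (unit_vec d 0)) e L ` Pow {..<L + M + 2}"
  \<comment> \<open>An arbitrary set \<open>A\<close> may decode to a point outside the ball, so the
    net is cut down to the ball.\<close>
  define Y where "Y = ?net \<inter> sorted_dual_ball d N"
  have ex: "\<exists>y\<in>Y. N x \<le> (1 + 2 * e) * ((1 + e) * (\<Sum>i<d. decr_coord x i * y i) + e * N x)"
    if x: "x \<in> carrier_vec d" for x
  proof -
    obtain A where "A \<subseteq> {..<L + M + 2}" "net_point d (N (unit_vec d 0)) e L A \<in> sorted_dual_ball d N"
      "N x \<le> (1 + 2 * e) *
        ((1 + e) * (\<Sum>i<d. decr_coord x i * net_point d (N (unit_vec d 0)) e L A i) + e * N x)"
      using symmetric_norm_net_point[OF N d e M L x] by blast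
    then show ?thesis by (intro bexI[of _ "net_point d (N (unit_vec d 0)) e L A"]) (auto simp: Y_def)
  qed
  show thesis
  proof (rule that[of Y])
    show "Y \<subseteq> sorted_dual_ball d N" "finite Y" by (auto simp: Y_def)
    show "Y \<noteq> {}" using ex[of "0\<^sub>v d"] by auto
    have "card Y \<le> card ?net" unfolding Y_def by (intro card_mono) auto
    also have "\<dots> \<le> card (Pow {..<L + M + 2})" by (rule card_image_le) simp
    finally show "card Y \<le> 2 ^ (L + M + 2)" by (simp add: card_Pow)
  qed (rule ex)
qed

text \<open>\<open>y d = 0\<close> removes the boundary term of the summation by parts.\<close>

lemma sum_differences_top_norm:
  assumes "x \<in> carrier_vec d" "y d = 0"
  shows "(\<Sum>k<d. (y k - y (Suc k)) * top_norm (Suc k) x) = (\<Sum>i<d. decr_coord x i * y i)"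
  unfolding sum_by_parts[of "decr_coord x" y]
  using assms by (simp add: top_norm_eq_sum_decr_coord del: sum.lessThan_Suc)

section \<open>Choice of parameters: accuracy and size of the net\<close>

text \<open>With \<open>e = \<delta> / 8\<close>, moving the terms in \<open>n\<close> to the left
  leaves the factor \<open>1 - e - 2 * e * e\<close>. For \<open>e < 1 / 16\<close> it is positive,
  and \<open>1 + 8 * e\<close> times it dominates \<open>(1 + 2 * e) * (1 + e)\<close>.\<close>

lemma net_accuracy:
  fixes s n \<delta> :: real
  assumes "0 < \<delta>" "\<delta> < 1 / 2" "0 \<le> n"
    and "n \<le> (1 + 2 * (\<delta> / 8)) * ((1 + \<delta> / 8) * s + \<delta> / 8 * n)"
  shows "n \<le> (1 + \<delta>) * s"
proof -
  define e where "e = \<delta> / 8"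
  have e: "0 < e" "e < 1 / 16" "\<delta> = 8 * e" using assms by (auto simp: e_def)
  have *: "n * (1 - e - 2 * e * e) \<le> (1 + 2 * e) * (1 + e) * s"
    using assms(4) unfolding e_def[symmetric] by (simp add: algebra_simps)
  have ee: "e * e \<le> e * (1 / 16)" using e by (intro mult_left_mono) auto
  have pos: "0 < 1 - e - 2 * e * e" using e(1,2) ee by linarith
  have s: "0 \<le> s"
  proof -
    have "0 \<le> n * (1 - e - 2 * e * e)" using assms(3) pos by simp
    then have "0 \<le> ((1 + 2 * e) * (1 + e)) * s" using * by linarith
    moreover have "0 < (1 + 2 * e) * (1 + e)" using e by simp
    ultimately show ?thesis by (simp add: zero_le_mult_iff)
  qed
  have "(1 + 2 * e) * (1 + e) = 1 + 3 * e + 2 * (e * e)" by (simp add: algebra_simps)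
  moreover have "(1 + 8 * e) * (1 - e - 2 * e * e) = 1 + 7 * e - 10 * (e * e) - 16 * (e * e) * e"
    by (simp add: algebra_simps)
  moreover have "(e * e) * e \<le> (e * e) * 1" using e by (intro mult_left_mono) auto
  ultimately have "(1 + 2 * e) * (1 + e) \<le> (1 + 8 * e) * (1 - e - 2 * e * e)"
    using e ee by linarith
  then have "(1 + 2 * e) * (1 + e) * s \<le> (1 + 8 * e) * (1 - e - 2 * e * e) * s"
    using s by (rule mult_right_mono)
  with * have "(1 - e - 2 * e * e) * n \<le> (1 - e - 2 * e * e) * ((1 + 8 * e) * s)"
    by (simp only: mult_ac)
  then show ?thesis using pos e(3) by simp
qed

text \<open>For \<open>e \<le> 1 / 2\<close>, \<open>ln (1 + e) \<ge> e - e * e \<ge> e / 2\<close>,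
  so an exponent of about \<open>2 * ln z / e\<close> suffices.\<close>

lemma power_one_plus_exceeds:
  fixes e z :: real
  assumes "0 < e" "e \<le> 1 / 2" "1 \<le> z"
  obtains n where "z \<le> (1 + e) ^ n" "real n \<le> 2 * ln z / e + 1"
proof -
  have "e * e \<le> e * (1 / 2)" using assms by (intro mult_left_mono) auto
  moreover have "e - e\<^sup>2 \<le> ln (1 + e)" using assms by (intro ln_one_plus_pos_lower_bound) auto
  ultimately have ln: "e / 2 \<le> ln (1 + e)" by (simp add: power2_eq_square)
  define n where "n = nat \<lceil>2 * ln z / e\<rceil>"
  have nonneg: "0 \<le> 2 * ln z / e" using assms by simp
  then have n: "2 * ln z / e \<le> real n" "real n \<le> 2 * ln z / e + 1"
    unfolding n_def by linarith+
  have "ln z = (2 * ln z / e) * (e / 2)" using assms by simp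
  also have "\<dots> \<le> real n * ln (1 + e)" using n ln nonneg assms by (intro mult_mono) auto
  also have "\<dots> = ln ((1 + e) ^ n)" using assms by (simp add: ln_realpow)
  finally have "z \<le> (1 + e) ^ n" using assms by simp
  then show thesis using n(2) by (rule that)
qed

text \<open>The exponent is of order \<open>(ln d + ln (1 / \<delta>)) / \<delta>\<close>. Since
  \<open>d \<ge> 2\<close> and \<open>\<delta> < 1 / 2\<close>, both logarithms are at least
  \<open>1 / 2\<close>, so their sum is bounded by a multiple of their product; this fails for
  \<open>d = 1\<close>.\<close>

lemma net_size:
  fixes \<delta> :: real
  assumes "2 \<le> d" "0 < \<delta>" "\<delta> < 1 / 2"
  obtains M L where "real d \<le> (1 + \<delta> / 8) ^ M" "real d / (\<delta> / 8) \<le> (1 + \<delta> / 8) ^ L"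
    and "2 ^ (L + M + 2) \<le> real d powr (200 * (ln (1 / \<delta>) * (1 / \<delta>)))"
proof -
  define e where "e = \<delta> / 8"
  have e: "0 < e" "e \<le> 1 / 2" using assms by (auto simp: e_def)
  obtain M where M: "real d \<le> (1 + e) ^ M" "real M \<le> 2 * ln (real d) / e + 1"
    using power_one_plus_exceeds[OF e, of "real d"] assms by auto
  have "1 \<le> real d / e" using assms e by (simp add: field_simps)
  then obtain L where L: "real d / e \<le> (1 + e) ^ L" "real L \<le> 2 * ln (real d / e) / e + 1"
    using power_one_plus_exceeds[OF e] by blast
  define x where "x = ln (real d)"
  define v where "v = ln (1 / \<delta>)"
  define w where "w = 1 / \<delta>"
  have half: "1 / 2 \<le> ln (2::real)" "ln (2::real) \<le> 1"
    using exp_half_le2 ln_ge_iff[of 2 "1 / 2"] ln_le_minus_one[of 2] by auto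
  have "ln 2 \<le> x" unfolding x_def using assms by (intro ln_mono) auto
  then have x: "1 / 2 \<le> x" using half by simp
  have "2 \<le> 1 / \<delta>" using assms by (simp add: field_simps)
  then have ln2v: "ln 2 \<le> v" unfolding v_def using assms by (intro ln_mono) auto
  then have v: "1 / 2 \<le> v" using half by simp
  have w: "2 \<le> w" using \<open>2 \<le> 1 / \<delta>\<close> by (simp add: w_def)
  have "ln (real d / e) = x + (ln 8 + v)"
    using assms by (simp add: x_def v_def e_def ln_div ln_mult)
  moreover have "ln (8::real) = 3 * ln 2" using ln_realpow[of 2 3] by simp
  ultimately have lnde: "ln (real d / e) \<le> x + 4 * v" using ln2v by simp
  have div_e: "u / e = 8 * (w * u)" for u by (simp add: e_def w_def)
  have "real M \<le> 16 * (w * x) + 1" using M(2) by (simp add: x_def div_e)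
  moreover have "real L \<le> 16 * (w * (x + 4 * v)) + 1"
  proof -
    have "2 * ln (real d / e) / e = 16 * (w * ln (real d / e))" unfolding div_e[of "2 * ln (real d / e)"] by simp
    also have "\<dots> \<le> 16 * (w * (x + 4 * v))" using lnde w by (intro mult_left_mono) auto
    finally show ?thesis using L(2) by linarith
  qed
  ultimately have n: "real (L + M + 2) \<le> 32 * (w * x) + 64 * (w * v) + 4" by (simp add: algebra_simps)
  define B where "B = x * (v * w)"
  have "w * x * (1 / 2) \<le> w * x * v" using v w x by (intro mult_left_mono) auto
  then have b1: "w * x \<le> 2 * B" by (simp add: B_def mult_ac)
  have "w * v * (1 / 2) \<le> w * v * x" using v w x by (intro mult_left_mono) auto
  then have b2: "w * v \<le> 2 * B" by (simp add: B_def mult_ac)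
  have "2 * (1 / 2) \<le> w * v" using v w by (intro mult_mono) auto
  \<comment> \<open>From \<open>1 \<le> w * v \<le> 2 * B\<close> the constant 4 is at most
    \<open>8 * B\<close>, and \<open>64 + 128 + 8 = 200\<close>.\<close>
  then have le_B: "real (L + M + 2) \<le> 200 * B" using n b1 b2 by linarith
  have "real (L + M + 2) * ln 2 \<le> real (L + M + 2) * 1"
    using half by (intro mult_left_mono) auto
  also have "\<dots> \<le> 200 * B" using le_B by (simp only: mult_1_right)
  finally have exponent: "real (L + M + 2) * ln 2 \<le> 200 * B" .
  have "(2::real) ^ (L + M + 2) = exp (real (L + M + 2) * ln 2)"
    by (subst exp_of_nat_mult) simp
  also have "\<dots> \<le> exp (200 * B)" using exponent by (simp only: exp_le_cancel_iff)
  also have "\<dots> = real d powr (200 * (ln (1 / \<delta>) * (1 / \<delta>)))"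
    using assms by (simp add: powr_def B_def x_def v_def w_def mult_ac)
  finally show thesis using M(1) L(1) that by (simp add: e_def)
qed

section \<open>The embedding\<close>

lemma linear_copy_map:
  assumes "1 \<le> d" shows "linear_vec_map d (t * (d * d)) (copy_map t d)"
  using assms by (auto simp: linear_vec_map_def copy_map_def)

lemma copy_map_diff:
  assumes "1 \<le> d" "x \<in> carrier_vec d" "y \<in> carrier_vec d"
  shows "copy_map t d x - copy_map t d y = copy_map t d (x - y)"
  using assms by (auto simp: copy_map_def)

text \<open>Coordinate \<open>j\<close> of inner block \<open>k\<close> of outer block
  \<open>i\<close> has index \<open>i * (d * d) + k * d + j\<close>, which is \<open>j\<close>
  modulo \<open>d\<close>.\<close>

lemma vec_block_copy_map:
  assumes x: "x \<in> carrier_vec d" and i: "i < t" and k: "k < d"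
  shows "vec_block d k (vec_block (d * d) i (copy_map t d x)) = x"
proof (rule eq_vecI)
  show "dim_vec (vec_block d k (vec_block (d * d) i (copy_map t d x))) = dim_vec x"
    using x by (simp add: vec_block_def)
  fix j assume "j < dim_vec x"
  then have j: "j < d" using x by simp
  have lt: "a * n + b < m * n" if "a < m" "b < n" for a b m n :: nat
  proof -
    have "a * n + b < Suc a * n" using that by simp
    also have "\<dots> \<le> m * n" using that by (intro mult_le_mono1) simp
    finally show ?thesis .
  qed
  have kj: "k * d + j < d * d" using k j by (rule lt)
  then have "i * (d * d) + (k * d + j) < t * (d * d)" by (rule lt[OF i])
  moreover have "(i * (d * d) + (k * d + j)) mod d = j"
  proof -
    have "i * (d * d) + (k * d + j) = j + d * (i * d + k)" by (simp add: algebra_simps)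
    then show ?thesis using j by (simp only: mod_mult_self2 mod_less)
  qed
  ultimately show "vec_block d k (vec_block (d * d) i (copy_map t d x)) $ j = x $ j"
    using j kj by (simp add: vec_block_def copy_map_def)
qed

lemma linf_sum_copy_map:
  assumes c: "c \<in> carrier_mat t d" and x: "x \<in> carrier_vec d"
  shows "linf_sum_l1_sum_top c (copy_map t d x) =
    Max ((\<lambda>i. \<Sum>k<d. c $$ (i, k) * top_norm (Suc k) x) ` {..<t})"
proof -
  have "l1_sum_top (row c i) (vec_block (d * d) i (copy_map t d x)) =
      (\<Sum>k<d. c $$ (i, k) * top_norm (Suc k) x)" if "i < t" for i
    using c that vec_block_copy_map[OF x that] by (simp add: l1_sum_top_def)
  then show ?thesis using c by (simp add: linf_sum_l1_sum_top_def cong: image_cong_simp)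
qed

text \<open>As the maximum never exceeds \<open>N\<close>, the scaling
  \<open>r = 1 / (1 + \<delta>)\<close> gives distortion \<open>1 + \<delta>\<close> rather than
  \<open>(1 + \<delta>) / (1 - \<delta>)\<close>. The lower bound with \<open>1 - \<delta>\<close>
  follows from \<open>(1 + \<delta>) * (1 - \<delta>) \<le> 1\<close>.\<close>

lemma embedding_of_max_bounds:
  fixes \<delta> :: real
  assumes N: "symmetric_norm_on d N" and d: "1 \<le> d" and \<delta>: "0 < \<delta>" and c: "c \<in> carrier_mat t d"
    and lower: "\<And>x. x \<in> carrier_vec d \<Longrightarrow>
      N x \<le> (1 + \<delta>) * Max ((\<lambda>i. \<Sum>k<d. c $$ (i, k) * top_norm (Suc k) x) ` {..<t})"
    and upper: "\<And>x. x \<in> carrier_vec d \<Longrightarrow>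
      Max ((\<lambda>i. \<Sum>k<d. c $$ (i, k) * top_norm (Suc k) x) ` {..<t}) \<le> N x"
  shows "(\<forall>x\<in>carrier_vec d.
          (1 - \<delta>) * N x \<le> Max ((\<lambda>i. \<Sum>k<d. c $$ (i, k) * top_norm (Suc k) x) ` {..<t}) \<and>
          Max ((\<lambda>i. \<Sum>k<d. c $$ (i, k) * top_norm (Suc k) x) ` {..<t}) \<le> (1 + \<delta>) * N x) \<and>
       linear_embedding_with_distortion (1 + \<delta>) d N (t * (d * d)) (linf_sum_l1_sum_top c)
         (copy_map t d)"
proof (intro conjI ballI)
  fix x :: "real vec" assume x: "x \<in> carrier_vec d"
  let ?m = "Max ((\<lambda>i. \<Sum>k<d. c $$ (i, k) * top_norm (Suc k) x) ` {..<t})"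
  have n: "0 \<le> N x" by (rule symmetric_norm_nonneg[OF N x])
  have "0 \<le> \<delta> * N x" using n \<delta> by simp
  then show "?m \<le> (1 + \<delta>) * N x" using upper[OF x] by (simp add: distrib_right)
  have "0 \<le> \<delta> * (\<delta> * N x)" using n \<delta> by simp
  then have "(1 + \<delta>) * ((1 - \<delta>) * N x) \<le> N x" by (simp add: algebra_simps)
  also have "\<dots> \<le> (1 + \<delta>) * ?m" by (rule lower[OF x])
  finally show "(1 - \<delta>) * N x \<le> ?m" using \<delta> by simp
next
  have "1 / (1 + \<delta>) * N (x - y) \<le> linf_sum_l1_sum_top c (copy_map t d x - copy_map t d y) \<and>
      linf_sum_l1_sum_top c (copy_map t d x - copy_map t d y) \<le> (1 + \<delta>) * (1 / (1 + \<delta>)) * N (x - y)"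
    if "x \<in> carrier_vec d" "y \<in> carrier_vec d" for x y
  proof -
    have xy: "x - y \<in> carrier_vec d" using that by simp
    show ?thesis
      unfolding copy_map_diff[OF d that] linf_sum_copy_map[OF c xy]
      using lower[OF xy] upper[OF xy] \<delta> by (simp add: pos_divide_le_eq mult.commute)
  qed
  then show "linear_embedding_with_distortion (1 + \<delta>) d N (t * (d * d)) (linf_sum_l1_sum_top c)
         (copy_map t d)"
    unfolding linear_embedding_with_distortion_def
    using linear_copy_map[OF d] \<delta> by (intro conjI exI[of _ "1 / (1 + \<delta>)"]) auto
qed

text \<open>Each \<open>y\<close> in \<open>Y\<close> becomes the row of its consecutive
  differences, nonnegative because \<open>y\<close> is antimono. Summation by parts identifies the
  row sums with pairings, which membership in the dual ball bounds by \<open>N\<close>.\<close>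

lemma sorted_dual_ball_matrix:
  fixes \<delta> :: real
  assumes N: "symmetric_norm_on d N" and d: "1 \<le> d" and \<delta>: "0 < \<delta>"
    and Y: "Y \<subseteq> sorted_dual_ball d N" "finite Y" "Y \<noteq> {}"
    and lower: "\<And>x. x \<in> carrier_vec d \<Longrightarrow> \<exists>y\<in>Y. N x \<le> (1 + \<delta>) * (\<Sum>i<d. decr_coord x i * y i)"
  shows "\<exists>c. c \<in> carrier_mat (card Y) d \<and> (\<forall>i<card Y. \<forall>k<d. 0 \<le> c $$ (i, k)) \<and>
       (\<forall>x\<in>carrier_vec d.
          (1 - \<delta>) * N x \<le> Max ((\<lambda>i. \<Sum>k<d. c $$ (i, k) * top_norm (Suc k) x) ` {..<card Y}) \<and>
          Max ((\<lambda>i. \<Sum>k<d. c $$ (i, k) * top_norm (Suc k) x) ` {..<card Y}) \<le> (1 + \<delta>) * N x) \<and>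
       linear_embedding_with_distortion (1 + \<delta>) d N (card Y * (d * d)) (linf_sum_l1_sum_top c)
         (copy_map (card Y) d)"
proof -
  obtain f where "bij_betw f {0..<card Y} Y" using ex_bij_betw_nat_finite[OF Y(2)] by blast
  then have f: "f ` {..<card Y} = Y" by (simp add: bij_betw_def atLeast0LessThan)
  define c where "c = mat (card Y) d (\<lambda>(i, k). f i k - f i (Suc k))"
  have c: "c \<in> carrier_mat (card Y) d" by (simp add: c_def)
  have ball: "f i \<in> sorted_dual_ball d N" if "i < card Y" for i using f Y(1) that by auto
  have max_eq: "(\<lambda>i. \<Sum>k<d. c $$ (i, k) * top_norm (Suc k) x) ` {..<card Y} =
      (\<lambda>y. \<Sum>i<d. decr_coord x i * y i) ` Y" if x: "x \<in> carrier_vec d" for x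
  proof -
    have "(\<Sum>k<d. c $$ (i, k) * top_norm (Suc k) x) = (\<Sum>j<d. decr_coord x j * f i j)"
      if "i < card Y" for i
      using that sum_differences_top_norm[OF x, of "f i"] ball[OF that]
      by (simp add: c_def sorted_dual_ball_def)
    then have "(\<lambda>i. \<Sum>k<d. c $$ (i, k) * top_norm (Suc k) x) ` {..<card Y} =
        (\<lambda>y. \<Sum>i<d. decr_coord x i * y i) ` f ` {..<card Y}"
      unfolding image_image by (intro image_cong) auto
    then show ?thesis by (simp only: f)
  qed
  have nonneg: "\<forall>i<card Y. \<forall>k<d. 0 \<le> c $$ (i, k)"
  proof (intro allI impI)
    fix i k assume "i < card Y" "k < d"
    then show "0 \<le> c $$ (i, k)"
      using ball[of i] antimonoD[of "f i" k "Suc k"] by (simp add: c_def sorted_dual_ball_def)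
  qed
  have lower': "N x \<le> (1 + \<delta>) * Max ((\<lambda>i. \<Sum>k<d. c $$ (i, k) * top_norm (Suc k) x) ` {..<card Y})"
    if x: "x \<in> carrier_vec d" for x
  proof -
    obtain y where "y \<in> Y" "N x \<le> (1 + \<delta>) * (\<Sum>i<d. decr_coord x i * y i)"
      using lower[OF x] by blast
    note this(2)
    also have "(1 + \<delta>) * (\<Sum>i<d. decr_coord x i * y i) \<le>
        (1 + \<delta>) * Max ((\<lambda>y. \<Sum>i<d. decr_coord x i * y i) ` Y)"
      using Y(2) \<open>y \<in> Y\<close> \<delta> by (intro mult_left_mono Max_ge) auto
    finally show ?thesis by (simp only: max_eq[OF x])
  qed
  have upper': "Max ((\<lambda>i. \<Sum>k<d. c $$ (i, k) * top_norm (Suc k) x) ` {..<card Y}) \<le> N x"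
    if x: "x \<in> carrier_vec d" for x
  proof -
    have "(\<Sum>i<d. decr_coord x i * y i) \<le> N x" if "y \<in> Y" for y
      using Y(1) x that by (auto simp: sorted_dual_ball_def)
    then show ?thesis unfolding max_eq[OF x] using Y(2,3) by simp
  qed
  show ?thesis
    by (rule exI[of _ c], intro conjI[OF c] conjI[OF nonneg])
      (rule embedding_of_max_bounds[OF N d \<delta> c lower' upper'])
qed

text \<open>For \<open>d = 1\<close> the size bound \<open>real d powr _\<close> equals 1, so only
  one row is allowed; one dual vector represents \<open>N\<close> exactly.\<close>

lemma symmetric_norm_dim_1:
  assumes "symmetric_norm_on 1 N"
  obtains y where "y \<in> sorted_dual_ball 1 N"
    and "\<And>x. x \<in> carrier_vec 1 \<Longrightarrow> N x = (\<Sum>i<1. decr_coord x i * y i)"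
proof -
  define a where "a = N (unit_vec 1 0)"
  have a: "0 \<le> a" unfolding a_def by (rule symmetric_norm_nonneg[OF assms]) simp
  have eq: "N x = decr_coord x 0 * a" if x: "x \<in> carrier_vec 1" for x
  proof -
    have "vec 1 (decr_coord x) = decr_coord x 0 \<cdot>\<^sub>v unit_vec 1 0" by (auto simp: unit_vec_def)
    then have "N x = N (decr_coord x 0 \<cdot>\<^sub>v unit_vec 1 0)"
      using norm_decr_coord[OF assms x] by (simp only:)
    also have "\<dots> = \<bar>decr_coord x 0\<bar> * a"
      unfolding a_def by (rule symmetric_norm_scale[OF assms]) simp
    finally show ?thesis using decr_coord_nonneg[of x 0] by simp
  qed
  let ?y = "\<lambda>i::nat. if i = 0 then a else 0"
  have sum: "(\<Sum>i<1. decr_coord x i * ?y i) = decr_coord x 0 * a" for x by simp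
  show thesis
  proof (rule that[of ?y])
    have "antimono ?y" using a by (auto simp: antimono_def)
    then show "?y \<in> sorted_dual_ball 1 N"
      unfolding sorted_dual_ball_def sum using a eq by simp
    show "N x = (\<Sum>i<1. decr_coord x i * ?y i)" if "x \<in> carrier_vec 1" for x
      unfolding sum by (rule eq[OF that])
  qed
qed

theorem theorem4p2:
  shows "\<exists>C>0. \<forall>(d::nat) (\<delta>::real) (N :: real vec \<Rightarrow> real).
    1 \<le> d \<longrightarrow> 0 < \<delta> \<longrightarrow> \<delta> < 1 / 2 \<longrightarrow> symmetric_norm_on d N \<longrightarrow>
    (\<exists>(t::nat) (c :: real mat).
       1 \<le> t \<and> real t \<le> real d powr (C * (ln (1 / \<delta>) * (1 / \<delta>))) \<and>
       c \<in> carrier_mat t d \<and> (\<forall>i<t. \<forall>k<d. 0 \<le> c $$ (i, k)) \<and>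
       (\<forall>x\<in>carrier_vec d.
          (1 - \<delta>) * N x \<le> Max ((\<lambda>i. \<Sum>k<d. c $$ (i, k) * top_norm (Suc k) x) ` {..<t}) \<and>
          Max ((\<lambda>i. \<Sum>k<d. c $$ (i, k) * top_norm (Suc k) x) ` {..<t}) \<le> (1 + \<delta>) * N x) \<and>
       linear_embedding_with_distortion (1 + \<delta>) d N (t * (d * d)) (linf_sum_l1_sum_top c)
         (copy_map t d))"
proof (intro exI[of _ "200::real"] conjI allI impI)
  fix d :: nat and \<delta> :: real and N :: "real vec \<Rightarrow> real"
  assume d: "1 \<le> d" and \<delta>: "0 < \<delta>" "\<delta> < 1 / 2" and N: "symmetric_norm_on d N"
  obtain Y where Y: "Y \<subseteq> sorted_dual_ball d N" "finite Y" "Y \<noteq> {}"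
    and size: "real (card Y) \<le> real d powr (200 * (ln (1 / \<delta>) * (1 / \<delta>)))"
    and lower: "\<And>x. x \<in> carrier_vec d \<Longrightarrow> \<exists>y\<in>Y. N x \<le> (1 + \<delta>) * (\<Sum>i<d. decr_coord x i * y i)"
  proof (cases "d = 1")
    case True
    then obtain y where y: "y \<in> sorted_dual_ball d N"
      "\<And>x. x \<in> carrier_vec d \<Longrightarrow> N x = (\<Sum>i<d. decr_coord x i * y i)"
      using symmetric_norm_dim_1 N by metis
    have "N x \<le> (1 + \<delta>) * (\<Sum>i<d. decr_coord x i * y i)" if "x \<in> carrier_vec d" for x
      using symmetric_norm_nonneg[OF N that] \<delta> unfolding y(2)[OF that, symmetric]
      by (simp add: distrib_right)
    then show thesis using y(1) True by (intro that[of "{y}"]) auto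
  next
    case False
    then have "2 \<le> d" using d by simp
    then obtain M L where M: "real d \<le> (1 + \<delta> / 8) ^ M" and L: "real d / (\<delta> / 8) \<le> (1 + \<delta> / 8) ^ L"
      and size: "2 ^ (L + M + 2) \<le> real d powr (200 * (ln (1 / \<delta>) * (1 / \<delta>)))"
      using net_size[OF _ \<delta>] by blast
    have "0 < d" "0 < \<delta> / 8" using d \<delta> by auto
    then obtain Y where Y: "Y \<subseteq> sorted_dual_ball d N" "finite Y" "Y \<noteq> {}"
      and card: "card Y \<le> 2 ^ (L + M + 2)"
      and net: "\<And>x. x \<in> carrier_vec d \<Longrightarrow> \<exists>y\<in>Y. N x \<le> (1 + 2 * (\<delta> / 8)) *
        ((1 + \<delta> / 8) * (\<Sum>i<d. decr_coord x i * y i) + \<delta> / 8 * N x)"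
      using symmetric_norm_net[OF N _ _ M L] by blast
    have "real (card Y) \<le> real (2 ^ (L + M + 2))" using card by (rule of_nat_mono)
    also have "\<dots> = 2 ^ (L + M + 2)" by simp
    also note size
    finally show thesis
      using Y net net_accuracy[OF \<delta> symmetric_norm_nonneg[OF N]] by (intro that[of Y]) blast+
  qed
  have "1 \<le> card Y" using Y(2,3) by (simp add: Suc_le_eq card_gt_0_iff)
  with size sorted_dual_ball_matrix[OF N d \<delta>(1) Y lower]
  show "\<exists>(t::nat) (c :: real mat).
       1 \<le> t \<and> real t \<le> real d powr (200 * (ln (1 / \<delta>) * (1 / \<delta>))) \<and>
       c \<in> carrier_mat t d \<and> (\<forall>i<t. \<forall>k<d. 0 \<le> c $$ (i, k)) \<and>
       (\<forall>x\<in>carrier_vec d.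
          (1 - \<delta>) * N x \<le> Max ((\<lambda>i. \<Sum>k<d. c $$ (i, k) * top_norm (Suc k) x) ` {..<t}) \<and>
          Max ((\<lambda>i. \<Sum>k<d. c $$ (i, k) * top_norm (Suc k) x) ` {..<t}) \<le> (1 + \<delta>) * N x) \<and>
       linear_embedding_with_distortion (1 + \<delta>) d N (t * (d * d)) (linf_sum_l1_sum_top c)
         (copy_map t d)"
    by (intro exI[of _ "card Y"]) blast
qed simp

end
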